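(* Let $K$ and $M$ be integers with $1\le M\le K-1$, let $q\ge K$ be a prime power and let $l\ge 1$. The Specialized GRS Code protocol (with parameters $K,M,q,l$) is a scalar-linear PIR-PCSI--I protocol, and its rate is $(K-M)^{-1}$.
   Context: Setup. Let $\mathcal{K}=\{1,\dots,K\}$, $\mathbb{F}_q^{\times}=\mathbb{F}_q\setminus\{0\}$ and $L=l\log_2 q$. Let $\mathcal{S}$ be the set of all $M$-subsets of $\mathcal{K}$ and $\mathcal{C}$ the set of all length-$M$ sequences over $\mathbb{F}_q^{\times}$. Boldface denotes random variables, regular letters their realizations; entropies are in bits. A server stores messages $\mathbf{X}_1,\dots,\mathbf{X}_K$, i.i.d. uniform on $\mathbb{F}_{q^l}$; write $\mathbf{X}_{\mathcal{K}}=\{\mathbf{X}_1,\dots,\mathbf{X}_K\}$. A user wants $X_W$ ($W\in\mathcal{K}$) and knows $Y^{[S,C]}=\sum_{i\in S}c_iX_i$, where $S=\{i_1,\dots,i_M\}\in\mathcal{S}$ and $C=(c_{i_1},\dots,c_{i_M})\in\mathcal{C}$. $\mathbf{S}$ is uniform on $\mathcal{S}$, $\mathbf{C}$ is uniform on $\mathcal{C}$ and independent of $(\mathbf{W},\mathbf{S})$, and the messages are independent of $(\mathbf{W},\mathbf{S},\mathbf{C})$. Model I: given $\mathbf{S}=S$, $\mathbf{W}$ is uniform on $\mathcal{K}\setminus S$ (so $\mathds{1}_{\{\mathbf{W}\in\mathbf{S}\}}=0$). A protocol consists of a query $\mathbf{Q}$, a possibly stochastic function of $(\mathbf{W},\mathbf{S},\mathbf{C})$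 only (extra randomness independent of the messages), and an answer $\mathbf{A}$, a deterministic function of $\mathbf{Q}$, $\mathds{1}_{\{\mathbf{W}\in\mathbf{S}\}}$ and $\mathbf{X}_{\mathcal{K}}$. It is a PIR-PCSI--I protocol if, under Model I, it satisfies recoverability, $H(\mathbf{X}_{\mathbf{W}}\mid \mathbf{A},\mathbf{Q},\mathds{1}_{\{\mathbf{W}\in\mathbf{S}\}},\mathbf{Y}^{[\mathbf{S},\mathbf{C}]},\mathbf{W},\mathbf{S},\mathbf{C})=0$, and $(W,S)$-privacy, $I(\mathbf{W},\mathbf{S};\mathbf{Q}\mid \mathds{1}_{\{\mathbf{W}\in\mathbf{S}\}})=0$ (equivalently, for every query $Q$ of positive probability the conditional distribution of $(\mathbf{W},\mathbf{S})$ given $\mathbf{Q}=Q$ equals its prior distribution under Model I). Its rate is $L/H(\mathbf{A}\mid \mathds{1}_{\{\mathbf{W}\in\mathbf{S}\}}=0)$. It is scalar-linear if the answer consists only of linear combinations of $X_1,\dots,X_K$ with coefficients in $\mathbb{F}_q$. Specialized GRS Code protocol. Fix $K$ distinct elements $\omega_1,\dots,\omega_K\in\mathbb{F}_q$ (chosen arbitrarily, not depending on $W,S,C$, and known to the server). Step 1: given $W,S,C$, the user forms $p(x)=\prod_{i\in\mathcal{K}\setminus(\{W\}\cup S)}(x-\omega_i)=\sum_{i=1}^{K-M}p_ix^{i-1}$. For $j\in S$ put $v_j=c_j/p(\omega_j)$; for $j\notin S$ choose $v_j$ uniformly at random from $\mathbb{F}_q^{\times}$ (independently of each other and of everything else).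 For $i=1,\dots,K-M$ let $Q_i=(v_1\omega_1^{i-1},\dots,v_K\omega_K^{i-1})$ (with the convention $0^0=1$). The query is $Q=(Q_1,\dots,Q_{K-M})$. Step 2: the server returns $A=(A_1,\dots,A_{K-M})$ with $A_i=\sum_{j=1}^{K}v_j\omega_j^{i-1}X_j$. Step 3: the user computes $\sum_{i=1}^{K-M}p_iA_i$, subtracts $Y^{[S,C]}$, and divides by the resulting nonzero coefficient of $X_W$. *)

theory Defs
  imports
    "HOL-Probability.Probability"
    "HOL-Computational_Algebra.Polynomial"
    "HOL-Number_Theory.Prime_Powers"
begin

section \<open>Information quantities, in bits, of random variables on a discrete space\<close>

text \<open>
  The library's entropies take the target measure spaces as arguments. The sample space is cut down
  to the support of the distribution, so that these can be counting measures on the values that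
  are actually attained; a counting measure on an uncountable type would not be sigma-finite.
\<close>

definition pmf_space :: "'o pmf \<Rightarrow> 'o measure" where
  "pmf_space p = restrict_space (measure_pmf p) (set_pmf p)"

definition pmf_entropy :: "'o pmf \<Rightarrow> ('o \<Rightarrow> 'a) \<Rightarrow> real" where
  "pmf_entropy p X = prob_space.entropy (pmf_space p) 2 (count_space (X ` set_pmf p)) X"

definition pmf_conditional_entropy :: "'o pmf \<Rightarrow> ('o \<Rightarrow> 'a) \<Rightarrow> ('o \<Rightarrow> 'b) \<Rightarrow> real" where
  "pmf_conditional_entropy p X Y =
    prob_space.conditional_entropy (pmf_space p) 2
      (count_space (X ` set_pmf p)) (count_space (Y ` set_pmf p)) X Y"

definition pmf_conditional_mutual_information ::
    "'o pmf \<Rightarrow> ('o \<Rightarrow> 'a) \<Rightarrow> ('o \<Rightarrow> 'b) \<Rightarrow> ('o \<Rightarrow> 'c) \<Rightarrow> real" where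
  "pmf_conditional_mutual_information p X Y Z =
    prob_space.conditional_mutual_information (pmf_space p) 2
      (count_space (X ` set_pmf p)) (count_space (Y ` set_pmf p)) (count_space (Z ` set_pmf p)) X Y Z"

lemma space_pmf_space [simp]: "space (pmf_space p) = set_pmf p"
  by (simp add: pmf_space_def space_restrict_space)

lemma sets_pmf_space [simp]: "sets (pmf_space p) = Pow (set_pmf p)"
  by (auto simp: pmf_space_def sets_restrict_space)

lemma information_space_pmf_space: "information_space (pmf_space p) 2"
proof -
  have "emeasure (measure_pmf p) (set_pmf p) = 1"
    by (simp add: measure_pmf.emeasure_eq_measure measure_pmf.prob_eq_1 AE_measure_pmf_iff)
  then have "prob_space (pmf_space p)"
    unfolding pmf_space_def by (intro prob_space_restrict_space) auto
  then show ?thesis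
    by (simp add: information_space_def information_space_axioms_def)
qed

lemma simple_function_pmf_space: "finite (X ` set_pmf p) \<Longrightarrow> simple_function (pmf_space p) X"
  by (simp add: simple_function_def)


section \<open>Private retrieval with private coded side information\<close>

text \<open>
  The base field is a finite type \<open>'f\<close>, the message alphabet is an extension field \<open>'e\<close>, and the
  inclusion of the former in the latter is a field homomorphism.
\<close>

definition field_embedding :: "('f::field \<Rightarrow> 'e::field) \<Rightarrow> bool" where
  "field_embedding emb \<longleftrightarrow>
    emb 1 = 1 \<and> (\<forall>x y. emb (x + y) = emb x + emb y) \<and> (\<forall>x y. emb (x * y) = emb x * emb y)"

text \<open>
  A sequence \<open>C\<close> is matched with the elements \<open>i\<^sub>1 < \<dots> < i\<^sub>M\<close> of \<open>S\<close> in increasing order: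
  \<open>coef S C i\<close> is the entry of \<open>C\<close> belonging to \<open>i \<in> S\<close>.
\<close>

definition coef :: "nat set \<Rightarrow> 'f list \<Rightarrow> nat \<Rightarrow> 'f" where
  "coef S C i = C ! card {j \<in> S. j < i}"

definition side_info ::
    "('f::field \<Rightarrow> 'e::field) \<Rightarrow> nat set \<Rightarrow> 'f list \<Rightarrow> (nat \<Rightarrow> 'e) \<Rightarrow> 'e" where
  "side_info emb S C X = (\<Sum>i\<in>S. emb (coef S C i) * X i)"

text \<open>
  A query depends stochastically on \<open>(W, S, C)\<close> only; an answer is a function of the query,
  of the truth value of \<open>W \<in> S\<close>, and of the messages.
\<close>

datatype ('f, 'e, 'q, 'a) protocol = Protocol
  (query: "nat \<Rightarrow> nat set \<Rightarrow> 'f list \<Rightarrow> 'q pmf")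
  (answer: "'q \<Rightarrow> bool \<Rightarrow> (nat \<Rightarrow> 'e) \<Rightarrow> 'a")

datatype ('f, 'e, 'q) outcome = Outcome
  (rv_W: nat) (rv_S: "nat set") (rv_C: "'f list") (rv_X: "nat \<Rightarrow> 'e") (rv_Q: 'q)

definition model_I :: "nat \<Rightarrow> nat \<Rightarrow> (nat \<times> nat set) pmf" where
  "model_I K M = do {
     S \<leftarrow> pmf_of_set {S. S \<subseteq> {1..K} \<and> card S = M};
     W \<leftarrow> pmf_of_set ({1..K} - S);
     return_pmf (W, S)
   }"

definition coef_pmf :: "nat \<Rightarrow> 'f::{field,finite} list pmf" where
  "coef_pmf M = pmf_of_set {C. length C = M \<and> set C \<subseteq> UNIV - {0}}"

definition messages_pmf :: "nat \<Rightarrow> (nat \<Rightarrow> 'e::{field,finite}) pmf" where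
  "messages_pmf K = Pi_pmf {1..K} 0 (\<lambda>_. pmf_of_set UNIV)"

definition run_I ::
    "nat \<Rightarrow> nat \<Rightarrow> ('f::{field,finite}, 'e::{field,finite}, 'q, 'a) protocol
      \<Rightarrow> ('f, 'e, 'q) outcome pmf" where
  "run_I K M P = do {
     (W, S) \<leftarrow> model_I K M;
     C \<leftarrow> coef_pmf M;
     X \<leftarrow> messages_pmf K;
     Q \<leftarrow> query P W S C;
     return_pmf (Outcome W S C X Q)
   }"

definition rv_ind :: "('f, 'e, 'q) outcome \<Rightarrow> bool" where
  "rv_ind \<xi> \<longleftrightarrow> rv_W \<xi> \<in> rv_S \<xi>"

definition rv_A :: "('f, 'e, 'q, 'a) protocol \<Rightarrow> ('f, 'e, 'q) outcome \<Rightarrow> 'a" where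
  "rv_A P \<xi> = answer P (rv_Q \<xi>) (rv_ind \<xi>) (rv_X \<xi>)"

definition rv_Y :: "('f::field \<Rightarrow> 'e::field) \<Rightarrow> ('f, 'e, 'q) outcome \<Rightarrow> 'e" where
  "rv_Y emb \<xi> = side_info emb (rv_S \<xi>) (rv_C \<xi>) (rv_X \<xi>)"

definition recoverable_I ::
    "nat \<Rightarrow> nat \<Rightarrow> ('f::{field,finite} \<Rightarrow> 'e::{field,finite}) \<Rightarrow> ('f, 'e, 'q, 'a) protocol \<Rightarrow> bool" where
  "recoverable_I K M emb P \<longleftrightarrow>
    pmf_conditional_entropy (run_I K M P)
      (\<lambda>\<xi>. rv_X \<xi> (rv_W \<xi>))
      (\<lambda>\<xi>. (rv_A P \<xi>, rv_Q \<xi>, rv_ind \<xi>, rv_Y emb \<xi>, rv_W \<xi>, rv_S \<xi>, rv_C \<xi>)) = 0"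

definition WS_private_I ::
    "nat \<Rightarrow> nat \<Rightarrow> ('f::{field,finite}, 'e::{field,finite}, 'q, 'a) protocol \<Rightarrow> bool" where
  "WS_private_I K M P \<longleftrightarrow>
    pmf_conditional_mutual_information (run_I K M P)
      (\<lambda>\<xi>. (rv_W \<xi>, rv_S \<xi>)) rv_Q rv_ind = 0"

definition PIR_PCSI_I ::
    "nat \<Rightarrow> nat \<Rightarrow> ('f::{field,finite} \<Rightarrow> 'e::{field,finite}) \<Rightarrow> ('f, 'e, 'q, 'a) protocol \<Rightarrow> bool" where
  "PIR_PCSI_I K M emb P \<longleftrightarrow> recoverable_I K M emb P \<and> WS_private_I K M P"

text \<open>\<open>L = l log\<^sub>2 q\<close> is the size of a message in bits.\<close>

definition rate_I ::
    "nat \<Rightarrow> nat \<Rightarrow> nat \<Rightarrow> nat \<Rightarrow> ('f::{field,finite}, 'e::{field,finite}, 'q, 'a) protocol \<Rightarrow> real" where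
  "rate_I K M q l P =
    (real l * log 2 (real q)) / pmf_entropy (cond_pmf (run_I K M P) {\<xi>. \<not> rv_ind \<xi>}) (rv_A P)"

definition scalar_linear ::
    "nat \<Rightarrow> ('f::field \<Rightarrow> 'e::field) \<Rightarrow> ('f, 'e, 'q, 'e list) protocol \<Rightarrow> bool" where
  "scalar_linear K emb P \<longleftrightarrow>
    (\<forall>Q b. \<exists>as :: (nat \<Rightarrow> 'f) list.
      \<forall>X. answer P Q b X = map (\<lambda>a. \<Sum>j\<in>{1..K}. emb (a j) * X j) as)"


section \<open>The Specialized GRS Code protocol\<close>

definition grs_poly :: "nat \<Rightarrow> (nat \<Rightarrow> 'f::field) \<Rightarrow> nat \<Rightarrow> nat set \<Rightarrow> 'f poly" where
  "grs_poly K \<omega> W S = (\<Prod>i\<in>{1..K} - ({W} \<union> S). [:- \<omega> i, 1:])"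

definition grs_multipliers ::
    "nat \<Rightarrow> (nat \<Rightarrow> 'f::{field,finite}) \<Rightarrow> nat \<Rightarrow> nat set \<Rightarrow> 'f list \<Rightarrow> (nat \<Rightarrow> 'f) pmf" where
  "grs_multipliers K \<omega> W S C =
    map_pmf (\<lambda>u j. if j \<in> S then coef S C j / poly (grs_poly K \<omega> W S) (\<omega> j) else u j)
      (Pi_pmf ({1..K} - S) 0 (\<lambda>_. pmf_of_set (UNIV - {0})))"

definition grs_query ::
    "nat \<Rightarrow> nat \<Rightarrow> (nat \<Rightarrow> 'f::{field,finite}) \<Rightarrow> nat \<Rightarrow> nat set \<Rightarrow> 'f list \<Rightarrow> 'f list list pmf" where
  "grs_query K M \<omega> W S C =
    map_pmf (\<lambda>v. map (\<lambda>i. map (\<lambda>j. v j * \<omega> j ^ (i - 1)) [1..<K + 1]) [1..<K - M + 1])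
      (grs_multipliers K \<omega> W S C)"

text \<open>
  The \<open>j\<close>-th entry \<open>v\<^sub>j \<omega>\<^sub>j\<^bsup>i-1\<^esup>\<close> of the query vector \<open>Q\<^sub>i\<close> is the coefficient of \<open>X\<^sub>j\<close> in \<open>A\<^sub>i\<close>.
  List positions start at \<open>0\<close>.
\<close>

definition grs_answer ::
    "nat \<Rightarrow> ('f::field \<Rightarrow> 'e::field) \<Rightarrow> 'f list list \<Rightarrow> bool \<Rightarrow> (nat \<Rightarrow> 'e) \<Rightarrow> 'e list" where
  "grs_answer K emb Q b X = map (\<lambda>Qi. \<Sum>j\<in>{1..K}. emb (Qi ! (j - 1)) * X j) Q"

definition grs_protocol ::
    "nat \<Rightarrow> nat \<Rightarrow> ('f::{field,finite} \<Rightarrow> 'e::field) \<Rightarrow> (nat \<Rightarrow> 'f)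
      \<Rightarrow> ('f, 'e, 'f list list, 'e list) protocol" where
  "grs_protocol K M emb \<omega> = Protocol (grs_query K M \<omega>) (grs_answer K emb)"

end

theory Submission
  imports Defs
begin

text \<open>
  Given \<open>(W, S)\<close>, the multipliers \<open>v\<^sub>j = c\<^sub>j / p(\<omega>\<^sub>j)\<close> with \<open>j \<in> S\<close> are independent and uniform over the nonzero
  scalars, because the \<open>c\<^sub>j\<close> are; so all of \<open>v\<close> is uniform whatever \<open>(W, S)\<close> is, and the query is independent
  of \<open>(W, S)\<close>. For any polynomial \<open>f\<close> of degree below \<open>K - M\<close> the answer determines \<open>\<Sum>\<^sub>j v\<^sub>j f(\<omega>\<^sub>j) X\<^sub>j\<close>. The
  choice \<open>f = p\<close> leaves only the terms in \<open>{W} \<union> S\<close>, those in \<open>S\<close> adding up to the side information. Choices of \<open>f\<close>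
  vanishing at all but one of \<open>K - M\<close> given positions show that, with the other messages fixed, the
  messages there correspond bijectively to the answers; so the answer is uniform on \<open>(K - M)\<close>-tuples and has
  entropy \<open>(K - M) L\<close>.
\<close>

section \<open>Entropies on the support of a discrete distribution\<close>

text \<open>Gives access to the finite-sum formulas for entropies, with every density expressed as
  the \<open>pmf\<close> of a mapped distribution.\<close>

lemma simple_distributed_pmf_space:
  assumes "finite (X ` set_pmf p)"
  shows "simple_distributed (pmf_space p) X (pmf (map_pmf X p))"
proof -
  interpret information_space "pmf_space p" 2
    by (rule information_space_pmf_space)
  show ?thesis
  proof (rule simple_distributedI)
    show "simple_function (pmf_space p) X"
      using assms by (rule simple_function_pmf_space)
    fix x
    have "measure (pmf_space p) (X -` {x} \<inter> set_pmf p) = measure (measure_pmf p) (X -` {x} \<inter> set_pmf p)"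
      unfolding pmf_space_def by (rule measure_restrict_space) auto
    then show "pmf (map_pmf X p) x = measure (pmf_space p) (X -` {x} \<inter> space (pmf_space p))"
      by (simp add: pmf_map measure_Int_set_pmf)
  qed simp
qed

lemma pmf_entropy_uniform:
  assumes "map_pmf X p = pmf_of_set A" "finite A" "A \<noteq> {}"
  shows "pmf_entropy p X = log 2 (real (card A))"
proof -
  interpret information_space "pmf_space p" 2
    by (rule information_space_pmf_space)
  have im: "X ` set_pmf p = A"
    using assms by (metis set_map_pmf set_pmf_of_set)
  then have "simple_distributed (pmf_space p) X (pmf (map_pmf X p))"
    using assms by (intro simple_distributed_pmf_space) auto
  from entropy_simple_distributed[OF this]
  have "pmf_entropy p X = - (\<Sum>x\<in>A. pmf (pmf_of_set A) x * log 2 (pmf (pmf_of_set A) x))"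
    by (simp add: pmf_entropy_def im assms(1))
  also have "\<dots> = - (\<Sum>x\<in>A. 1 / real (card A) * log 2 (1 / real (card A)))"
    using assms by (intro arg_cong[where f = uminus] sum.cong) auto
  also have "\<dots> = log 2 (real (card A))"
    using assms by (simp add: log_divide card_gt_0_iff)
  finally show ?thesis .
qed

text \<open>On the support \<open>(X, Y)\<close> is an injective image of \<open>Y\<close>. Each
  value of the pair is thus as likely as its second component, and every logarithm in the sum is
  \<open>log 2 1\<close>.\<close>

lemma pmf_conditional_entropy_determined:
  assumes "finite (Y ` set_pmf p)"
    and det: "\<And>\<xi> \<xi>'. \<xi> \<in> set_pmf p \<Longrightarrow> \<xi>' \<in> set_pmf p \<Longrightarrow> Y \<xi> = Y \<xi>' \<Longrightarrow> X \<xi> = X \<xi>'"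
  shows "pmf_conditional_entropy p X Y = 0"
proof -
  interpret information_space "pmf_space p" 2
    by (rule information_space_pmf_space)
  \<comment> \<open>\<open>g\<close> reads off \<open>X\<close> from an arbitrary outcome in the
    fibre of \<open>Y\<close>; by \<open>det\<close> the choice does not matter.\<close>
  define g where "g y = X (SOME \<xi>. \<xi> \<in> set_pmf p \<and> Y \<xi> = y)" for y
  have g: "X \<xi> = g (Y \<xi>)" if "\<xi> \<in> set_pmf p" for \<xi>
    using someI[of "\<lambda>\<xi>'. \<xi>' \<in> set_pmf p \<and> Y \<xi>' = Y \<xi>" \<xi>] that unfolding g_def
    by (intro det) auto
  have im: "(\<lambda>\<xi>. (X \<xi>, Y \<xi>)) ` set_pmf p = (\<lambda>y. (g y, y)) ` Y ` set_pmf p"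
    using g by (auto simp: image_image)
  have map_eq: "map_pmf (\<lambda>\<xi>. (X \<xi>, Y \<xi>)) p = map_pmf (\<lambda>y. (g y, y)) (map_pmf Y p)"
    unfolding pmf.map_comp using g by (intro map_pmf_cong) auto
  have "pmf_conditional_entropy p X Y
      = - (\<Sum>(x, y)\<in>(\<lambda>\<xi>. (X \<xi>, Y \<xi>)) ` set_pmf p. pmf (map_pmf (\<lambda>\<xi>. (X \<xi>, Y \<xi>)) p) (x, y) *
          log 2 (pmf (map_pmf (\<lambda>\<xi>. (X \<xi>, Y \<xi>)) p) (x, y) / pmf (map_pmf Y p) y))"
    unfolding pmf_conditional_entropy_def
    using conditional_entropy_eq[OF simple_distributed_pmf_space[of Y p]
      simple_distributed_pmf_space[of "\<lambda>\<xi>. (X \<xi>, Y \<xi>)" p]] assms(1)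
    by (simp add: im)
  also have "\<dots> = 0"
    unfolding neg_equal_0_iff_equal
  proof (rule sum.neutral, safe)
    fix \<xi> assume "\<xi> \<in> set_pmf p"
    have "pmf (map_pmf (\<lambda>\<xi>. (X \<xi>, Y \<xi>)) p) (g (Y \<xi>), Y \<xi>) = pmf (map_pmf Y p) (Y \<xi>)"
      unfolding map_eq by (rule pmf_map_inj') (auto simp: inj_on_def)
    moreover have "pmf (map_pmf Y p) (Y \<xi>) \<noteq> 0"
      using \<open>\<xi> \<in> set_pmf p\<close> by (auto simp: pmf_eq_0_set_pmf)
    ultimately show "pmf (map_pmf (\<lambda>\<xi>. (X \<xi>, Y \<xi>)) p) (X \<xi>, Y \<xi>) *
          log 2 (pmf (map_pmf (\<lambda>\<xi>. (X \<xi>, Y \<xi>)) p) (X \<xi>, Y \<xi>) / pmf (map_pmf Y p) (Y \<xi>)) = 0"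
      using g[OF \<open>\<xi> \<in> set_pmf p\<close>] by simp
  qed
  finally show ?thesis .
qed

text \<open>Conditioning on a constant changes no probability, and the product law then makes
  numerator and denominator equal inside each logarithm.\<close>

lemma pmf_conditional_mutual_information_indep:
  assumes fin: "finite (X ` set_pmf p)" "finite (Y ` set_pmf p)"
    and indep: "map_pmf (\<lambda>\<xi>. (X \<xi>, Y \<xi>)) p = pair_pmf A B"
    and const: "\<And>\<xi>. \<xi> \<in> set_pmf p \<Longrightarrow> Z \<xi> = z"
  shows "pmf_conditional_mutual_information p X Y Z = 0"
proof -
  interpret information_space "pmf_space p" 2
    by (rule information_space_pmf_space)
  have A: "map_pmf X p = A"
    using arg_cong[OF indep, of "map_pmf fst"] by (simp add: pmf.map_comp o_def map_fst_pair_pmf)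
  have B: "map_pmf Y p = B"
    using arg_cong[OF indep, of "map_pmf snd"] by (simp add: pmf.map_comp o_def map_snd_pair_pmf)
  have const_map: "map_pmf (\<lambda>\<xi>. (V \<xi>, Z \<xi>)) p = map_pmf (\<lambda>v. (v, z)) (map_pmf V p)" for V :: "_ \<Rightarrow> 'v"
    unfolding pmf.map_comp using const by (intro map_pmf_cong) auto
  have "map_pmf Z p = map_pmf (\<lambda>_. z) p"
    using const by (intro map_pmf_cong) auto
  then have pz: "pmf (map_pmf Z p) z = 1"
    by (simp add: map_pmf_const)
  have px: "pmf (map_pmf (\<lambda>\<xi>. (X \<xi>, Z \<xi>)) p) (x, z) = pmf A x" for x
    unfolding const_map A by (rule pmf_map_inj') (auto simp: inj_on_def)
  have py: "pmf (map_pmf (\<lambda>\<xi>. (Y \<xi>, Z \<xi>)) p) (y, z) = pmf B y" for y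
    unfolding const_map B by (rule pmf_map_inj') (auto simp: inj_on_def)
  have "map_pmf (\<lambda>\<xi>. (X \<xi>, Y \<xi>, Z \<xi>)) p = map_pmf (\<lambda>(x, y). (x, y, z)) (pair_pmf A B)"
    unfolding indep[symmetric] pmf.map_comp using const by (intro map_pmf_cong) auto
  then have pxy: "pmf (map_pmf (\<lambda>\<xi>. (X \<xi>, Y \<xi>, Z \<xi>)) p) (x, y, z) = pmf A x * pmf B y" for x y
    using pmf_map_inj'[of "\<lambda>(x, y). (x, y, z)" "pair_pmf A B" "(x, y)"]
    by (auto simp: inj_on_def pmf_pair)
  have finZ: "finite (Z ` set_pmf p)"
    by (rule finite_subset[of _ "{z}"]) (auto dest: const)
  have finP: "finite ((\<lambda>\<xi>. (V \<xi>, U \<xi>)) ` set_pmf p)"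
    if "finite (V ` set_pmf p)" "finite (U ` set_pmf p)" for V :: "_ \<Rightarrow> 'v" and U :: "_ \<Rightarrow> 'u"
    by (rule finite_subset[OF _ finite_cartesian_product[OF that]]) auto
  note sd = simple_distributed_pmf_space
  have "pmf_conditional_mutual_information p X Y Z =
      (\<Sum>(x, y, z)\<in>(\<lambda>\<xi>. (X \<xi>, Y \<xi>, Z \<xi>)) ` set_pmf p.
        pmf (map_pmf (\<lambda>\<xi>. (X \<xi>, Y \<xi>, Z \<xi>)) p) (x, y, z) *
        log 2 (pmf (map_pmf (\<lambda>\<xi>. (X \<xi>, Y \<xi>, Z \<xi>)) p) (x, y, z) /
          (pmf (map_pmf (\<lambda>\<xi>. (X \<xi>, Z \<xi>)) p) (x, z) *
            (pmf (map_pmf (\<lambda>\<xi>. (Y \<xi>, Z \<xi>)) p) (y, z) / pmf (map_pmf Z p) z))))"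
    unfolding pmf_conditional_mutual_information_def
    using conditional_mutual_information_eq[OF sd sd sd sd, OF finZ finP finP finP,
        OF fin(2) finZ fin(1) finZ fin(1) finP, OF fin(2) finZ]
    by simp
  also have "\<dots> = 0"
  proof (rule sum.neutral, safe)
    fix \<xi> assume "\<xi> \<in> set_pmf p"
    then have "pmf A (X \<xi>) \<noteq> 0" "pmf B (Y \<xi>) \<noteq> 0"
      by (auto simp: pmf_eq_0_set_pmf A[symmetric] B[symmetric])
    then show "pmf (map_pmf (\<lambda>\<xi>. (X \<xi>, Y \<xi>, Z \<xi>)) p) (X \<xi>, Y \<xi>, Z \<xi>) *
        log 2 (pmf (map_pmf (\<lambda>\<xi>. (X \<xi>, Y \<xi>, Z \<xi>)) p) (X \<xi>, Y \<xi>, Z \<xi>) /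
          (pmf (map_pmf (\<lambda>\<xi>. (X \<xi>, Z \<xi>)) p) (X \<xi>, Z \<xi>) *
            (pmf (map_pmf (\<lambda>\<xi>. (Y \<xi>, Z \<xi>)) p) (Y \<xi>, Z \<xi>) / pmf (map_pmf Z p) (Z \<xi>)))) = 0"
      by (simp add: const[OF \<open>\<xi> \<in> set_pmf p\<close>] px py pxy pz)
  qed
  finally show ?thesis .
qed

text \<open>Removes the conditioning in the rate: under Model I it is certain that \<open>W\<close>
  lies outside \<open>S\<close>.\<close>

lemma cond_pmf_superset:
  assumes "set_pmf p \<subseteq> A"
  shows "cond_pmf p A = p"
proof (rule pmf_eqI)
  fix x
  have "measure (measure_pmf p) A = 1"
    using assms by (auto simp: measure_pmf.prob_eq_1 AE_measure_pmf_iff)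
  moreover have "set_pmf p \<inter> A \<noteq> {}"
    using assms set_pmf_not_empty[of p] by auto
  ultimately show "pmf (cond_pmf p A) x = pmf p x"
    using assms by (auto simp: pmf_cond pmf_eq_0_set_pmf)
qed


section \<open>Generalized Reed-Solomon codes\<close>

text \<open>Lets counting replace explicit inverses in the bijections below: messages to answers,
  elements to ranks, coefficient lists to multipliers.\<close>

lemma bij_betw_inj_card_eq:
  assumes "finite B" "inj_on f A" "f ` A \<subseteq> B" "card A = card B"
  shows "bij_betw f A B"
  using assms card_subset_eq[of B "f ` A"] by (simp add: bij_betw_def card_image)

section \<open>Embeddings of the base field into the message field\<close>

lemma field_embedding_0:
  assumes "field_embedding emb"
  shows "emb 0 = 0"
proof -
  have "emb (0 + 0) = emb 0 + emb 0"
    using assms unfolding field_embedding_def by blast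
  then have "emb 0 + 0 = emb 0 + emb 0"
    by (simp only: add_0_right)
  then show ?thesis
    by (simp only: add_left_cancel)
qed

lemma field_embedding_eq_0_iff:
  assumes "field_embedding emb"
  shows "emb x = 0 \<longleftrightarrow> x = 0"
proof
  assume "emb x = 0"
  show "x = 0"
  proof (rule ccontr)
    assume "x \<noteq> 0"
    then have "emb 1 = emb (x * inverse x)"
      by simp
    also have "\<dots> = emb x * emb (inverse x)"
      using assms unfolding field_embedding_def by blast
    finally have "emb 1 = emb x * emb (inverse x)" .
    then show False
      using assms \<open>emb x = 0\<close> by (simp add: field_embedding_def)
  qed
qed (simp add: assms field_embedding_0)

lemma field_embedding_sum:
  assumes "field_embedding emb"
  shows "emb (sum f A) = (\<Sum>x\<in>A. emb (f x))"
  using assms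
  by (induction A rule: infinite_finite_induct) (auto simp: field_embedding_0, simp add: field_embedding_def)

text \<open>The generator matrix of a generalized Reed-Solomon code of length \<open>K\<close> and
  dimension \<open>n\<close>. Fixing \<open>v\<close> separates the algebra of the code from the
  random choice of multipliers.\<close>

definition grs_matrix :: "nat \<Rightarrow> nat \<Rightarrow> (nat \<Rightarrow> 'f::field) \<Rightarrow> (nat \<Rightarrow> 'f) \<Rightarrow> 'f list list" where
  "grs_matrix K n \<omega> v = map (\<lambda>i. map (\<lambda>j. v j * \<omega> j ^ (i - 1)) [1..<K + 1]) [1..<n + 1]"

lemma grs_query_eq: "grs_query K M \<omega> W S C = map_pmf (grs_matrix K (K - M) \<omega>) (grs_multipliers K \<omega> W S C)"
  unfolding grs_query_def grs_matrix_def ..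

lemma grs_answer_matrix:
  "grs_answer K emb (grs_matrix K n \<omega> v) b X
    = map (\<lambda>i. \<Sum>j\<in>{1..K}. emb (v j * \<omega> j ^ (i - 1)) * X j) [1..<n + 1]"
  unfolding grs_answer_def grs_matrix_def map_map o_def
  by (intro map_cong refl sum.cong) (auto simp del: upt_Suc)

text \<open>Each row of the matrix gives the claim for one monomial, and linearity extends it to
  \<open>f\<close>. Recoverability and the injectivity of the answer both come from a suitable
  \<open>f\<close>.\<close>

lemma grs_poly_annihilates:
  fixes emb :: "'f::field \<Rightarrow> 'e::field"
  assumes emb: "field_embedding emb"
    and eq: "grs_answer K emb (grs_matrix K n \<omega> v) b X = grs_answer K emb (grs_matrix K n \<omega> v) b' X'"
    and deg: "degree f < n"
  shows "(\<Sum>j\<in>{1..K}. emb (v j * poly f (\<omega> j)) * (X j - X' j)) = 0"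
proof -
  \<comment> \<open>List position \<open>i\<close> holds row \<open>i + 1\<close>, whose exponent is
    \<open>i\<close>.\<close>
  have row: "(\<Sum>j\<in>{1..K}. emb (v j * \<omega> j ^ i) * (X j - X' j)) = 0" if "i < n" for i
    using arg_cong[OF eq, of "\<lambda>xs. xs ! i"] that
    by (simp add: grs_answer_matrix right_diff_distrib sum_subtractf del: upt_Suc)
  have "(\<Sum>j\<in>{1..K}. emb (v j * poly f (\<omega> j)) * (X j - X' j))
      = (\<Sum>j\<in>{1..K}. \<Sum>i\<le>degree f. emb (coeff f i) * (emb (v j * \<omega> j ^ i) * (X j - X' j)))"
  proof (rule sum.cong)
    fix j
    have "v j * poly f (\<omega> j) = (\<Sum>i\<le>degree f. coeff f i * (v j * \<omega> j ^ i))"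
      by (simp add: poly_altdef sum_distrib_left mult_ac)
    moreover have "emb (x * y) = emb x * emb y" for x y
      using emb by (simp add: field_embedding_def)
    ultimately show "emb (v j * poly f (\<omega> j)) * (X j - X' j)
        = (\<Sum>i\<le>degree f. emb (coeff f i) * (emb (v j * \<omega> j ^ i) * (X j - X' j)))"
      by (simp add: field_embedding_sum[OF emb] sum_distrib_right mult.assoc)
  qed simp
  \<comment> \<open>Exchanging the sums isolates the row sums; the degree bound ensures that only
    rows of the matrix occur.\<close>
  also have "\<dots> = (\<Sum>i\<le>degree f. emb (coeff f i) * (\<Sum>j\<in>{1..K}. emb (v j * \<omega> j ^ i) * (X j - X' j)))"
    by (subst sum.swap) (simp add: sum_distrib_left)
  also have "\<dots> = 0"
    using deg row by (intro sum.neutral ballI) simp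
  finally show ?thesis .
qed

lemma poly_prod_linear_eq_0_iff:
  fixes \<omega> :: "'i \<Rightarrow> 'f::field"
  assumes "finite A"
  shows "poly (\<Prod>i\<in>A. [:- \<omega> i, 1:]) x = 0 \<longleftrightarrow> (\<exists>i\<in>A. \<omega> i = x)"
  using assms by (auto simp: poly_prod)

lemma degree_prod_linear:
  fixes \<omega> :: "'i \<Rightarrow> 'f::field"
  shows "degree (\<Prod>i\<in>A. [:- \<omega> i, 1:]) = card A"
  by (subst degree_prod_eq_sum_degree) auto

text \<open>The maximum distance separable property of the code.\<close>

lemma grs_answer_inj:
  fixes emb :: "'f::field \<Rightarrow> 'e::field"
  assumes emb: "field_embedding emb" and \<omega>: "inj_on \<omega> {1..K}"
    and v: "\<And>j. j \<in> {1..K} \<Longrightarrow> v j \<noteq> 0"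
    and T: "T \<subseteq> {1..K}" "card T = n"
    and agree: "\<And>j. j \<in> {1..K} - T \<Longrightarrow> X j = X' j"
    and eq: "grs_answer K emb (grs_matrix K n \<omega> v) b X = grs_answer K emb (grs_matrix K n \<omega> v) b' X'"
    and k: "k \<in> T"
  shows "X k = X' k"
proof -
  \<comment> \<open>Up to a scalar, the Lagrange basis polynomial of \<open>k\<close> on the points
    of \<open>T\<close>; its degree is \<open>n - 1\<close>.\<close>
  let ?f = "\<Prod>i\<in>T - {k}. [:- \<omega> i, 1:]"
  have "finite T"
    using T(1) finite_subset by blast
  then have "degree ?f < n"
    using card_Diff1_less[of T k] T k by (simp only: degree_prod_linear)
  then have "0 = (\<Sum>j\<in>{1..K}. emb (v j * poly ?f (\<omega> j)) * (X j - X' j))"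
    using grs_poly_annihilates[OF emb eq] by simp
  \<comment> \<open>Positions in \<open>T - {k}\<close> drop out because \<open>?f\<close> vanishes
    there, positions outside \<open>T\<close> because the messages agree.\<close>
  also have "\<dots> = (\<Sum>j\<in>{k}. emb (v j * poly ?f (\<omega> j)) * (X j - X' j))"
  proof (rule sum.mono_neutral_right)
    show "\<forall>j\<in>{1..K} - {k}. emb (v j * poly ?f (\<omega> j)) * (X j - X' j) = 0"
    proof
      fix j assume j: "j \<in> {1..K} - {k}"
      show "emb (v j * poly ?f (\<omega> j)) * (X j - X' j) = 0"
      proof (cases "j \<in> T")
        case True
        then have "poly ?f (\<omega> j) = 0"
          using j \<open>finite T\<close> by (subst poly_prod_linear_eq_0_iff) auto
        then show ?thesis
          by (simp add: field_embedding_0[OF emb])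
      qed (use agree j in auto)
    qed
  qed (use k T in auto)
  finally have "emb (v k * poly ?f (\<omega> k)) * (X k - X' k) = 0"
    by simp
  moreover have "poly ?f (\<omega> k) \<noteq> 0"
    using \<open>finite T\<close> k
    by (subst poly_prod_linear_eq_0_iff) (auto simp: inj_on_eq_iff[OF inj_on_subset[OF \<omega> T(1)]])
  moreover have "v k \<noteq> 0"
    using v T k by auto
  ultimately show ?thesis
    by (simp add: field_embedding_eq_0_iff[OF emb])
qed

text \<open>With the messages outside \<open>{1..n}\<close> fixed, the others determine the answer
  bijectively, so it is uniform. This conditional law is the same for all fixed parts, hence
  survives averaging.\<close>

lemma map_pmf_grs_answer:
  fixes emb :: "'f::field \<Rightarrow> 'e::{field,finite}"
  assumes emb: "field_embedding emb" and \<omega>: "inj_on \<omega> {1..K}"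
    and v: "\<And>j. j \<in> {1..K} \<Longrightarrow> v j \<noteq> 0" and "n \<le> K"
  shows "map_pmf (grs_answer K emb (grs_matrix K n \<omega> v) b) (messages_pmf K)
    = pmf_of_set {xs. length xs = n}"
proof -
  let ?A = "grs_answer K emb (grs_matrix K n \<omega> v) b"
  let ?U = "pmf_of_set {xs :: 'e list. length xs = n}"
  let ?Pi = "\<lambda>T. Pi_pmf T 0 (\<lambda>_. pmf_of_set (UNIV :: 'e set))"
  define merge :: "(nat \<Rightarrow> 'e) \<Rightarrow> (nat \<Rightarrow> 'e) \<Rightarrow> nat \<Rightarrow> 'e"
    where "merge f g x = (if x \<in> {1..n} then f x else g x)" for f g x
  have inner: "map_pmf (\<lambda>f. ?A (merge f g)) (?Pi {1..n}) = ?U" for g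
  proof -
    let ?D = "PiE_dflt {1..n} 0 (\<lambda>_. UNIV :: 'e set)"
    have "bij_betw (\<lambda>f. ?A (merge f g)) ?D {xs. length xs = n}"
    proof (rule bij_betw_inj_card_eq)
      show "finite {xs :: 'e list. length xs = n}"
        using finite_lists_length_eq[of "UNIV :: 'e set" n] by simp
      show "inj_on (\<lambda>f. ?A (merge f g)) ?D"
      proof (rule inj_onI, rule ext)
        fix f f' k assume f: "f \<in> ?D" "f' \<in> ?D" and eq: "?A (merge f g) = ?A (merge f' g)"
        show "f k = f' k"
        proof (cases "k \<in> {1..n}")
          case True
          have "merge f g k = merge f' g k"
            by (rule grs_answer_inj[OF emb \<omega> v _ _ _ eq True]) (use \<open>n \<le> K\<close> in \<open>auto simp: merge_def\<close>)
          then show ?thesis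
            using True by (simp add: merge_def)
        next
          \<comment> \<open>Outside \<open>{1..n}\<close> all members of \<open>?D\<close> take the
            default value 0.\<close>
          case False
          then show ?thesis
            using f unfolding PiE_dflt_def by (metis (mono_tags, lifting) mem_Collect_eq)
        qed
      qed
      show "(\<lambda>f. ?A (merge f g)) ` ?D \<subseteq> {xs. length xs = n}"
        by (auto simp: grs_answer_matrix simp del: upt_Suc)
      show "card ?D = card {xs :: 'e list. length xs = n}"
        using card_lists_length_eq[of "UNIV :: 'e set" n] by (simp add: card_PiE_dflt)
    qed
    then show ?thesis
      by (subst Pi_pmf_of_set) (auto intro!: map_pmf_of_set_bij_betw)
  qed
  have "{1..K} = {1..n} \<union> {n<..K}"
    using \<open>n \<le> K\<close> by auto
  then have "messages_pmf K = map_pmf (\<lambda>(f, g). merge f g) (pair_pmf (?Pi {1..n}) (?Pi {n<..K}))"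
    unfolding messages_pmf_def merge_def[abs_def] by (simp, subst Pi_pmf_union) auto
  \<comment> \<open>The fixed part \<open>g\<close> is drawn first, so that \<open>inner\<close>
    applies under the outer bind.\<close>
  also have "\<dots> = bind_pmf (?Pi {n<..K}) (\<lambda>g. map_pmf (\<lambda>f. merge f g) (?Pi {1..n}))"
    unfolding pair_pmf_def map_bind_pmf
    by (subst bind_commute_pmf) (simp add: map_pmf_def bind_assoc_pmf bind_return_pmf)
  finally have "map_pmf ?A (messages_pmf K)
      = bind_pmf (?Pi {n<..K}) (\<lambda>g. map_pmf (\<lambda>f. ?A (merge f g)) (?Pi {1..n}))"
    by (simp add: map_bind_pmf pmf.map_comp o_def)
  then show ?thesis
    by (simp only: inner bind_pmf_const)
qed


section \<open>The distribution of the query\<close>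

text \<open>The rank of \<open>i\<close> in \<open>S\<close> is the position that
  \<open>coef\<close> looks up; thus every entry of a coefficient list belongs to exactly one
  element of \<open>S\<close>.\<close>

lemma bij_betw_rank:
  fixes S :: "nat set"
  assumes "finite S"
  shows "bij_betw (\<lambda>i. card {j \<in> S. j < i}) S {..<card S}"
proof (rule bij_betw_inj_card_eq)
  let ?r = "\<lambda>i. card {j \<in> S. j < i}"
  \<comment> \<open>Serves twice: with \<open>T = {j \<in> S. j < i'}\<close> it gives strict
    monotonicity, with \<open>T = S\<close> the bound on ranks.\<close>
  have less: "?r i < card T" if "i \<in> T" "T \<subseteq> S" "{j \<in> S. j < i} \<subseteq> T" for i T
  proof (rule psubset_card_mono)
    show "finite T"
      using that assms finite_subset by blast
    show "{j \<in> S. j < i} \<subset> T"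
      using that by blast
  qed
  have mono: "?r i < ?r i'" if "i \<in> S" "i < i'" for i i'
    by (rule less) (use that in auto)
  show "inj_on ?r S"
  proof (rule inj_onI, rule ccontr)
    fix i i' assume "i \<in> S" "i' \<in> S" "?r i = ?r i'" "i \<noteq> i'"
    then show False
      using mono[of i i'] mono[of i' i] by (cases "i < i'") auto
  qed
  show "?r ` S \<subseteq> {..<card S}"
  proof (rule image_subsetI)
    fix i assume "i \<in> S"
    then show "?r i \<in> {..<card S}"
      using less[of i S] by simp
  qed
qed auto

text \<open>Division by a fixed nonzero scalar permutes the nonzero scalars. Coefficient lists
  therefore correspond bijectively to nonzero-valued functions on \<open>S\<close>, the default 0
  filling in elsewhere.\<close>

lemma map_pmf_coef:
  fixes a :: "nat \<Rightarrow> 'f::{field,finite}"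
  assumes "finite S" and a: "\<And>j. j \<in> S \<Longrightarrow> a j \<noteq> 0"
  shows "map_pmf (\<lambda>C j. if j \<in> S then coef S C j / a j else 0) (coef_pmf (card S))
    = Pi_pmf S 0 (\<lambda>_. pmf_of_set (UNIV - {0}))"
proof -
  let ?L = "{C :: 'f list. length C = card S \<and> set C \<subseteq> UNIV - {0}}"
  let ?D = "PiE_dflt S 0 (\<lambda>_. UNIV - {0 :: 'f})"
  let ?h = "\<lambda>C j. if j \<in> S then coef S C j / a j else 0"
  have cardL: "card ?L = card (UNIV - {0 :: 'f}) ^ card S" and finL: "finite ?L"
    using card_lists_length_eq[of "UNIV - {0 :: 'f}" "card S"]
      finite_lists_length_eq[of "UNIV - {0 :: 'f}" "card S"] by (simp_all add: conj_commute)
  have ne: "UNIV - {0 :: 'f} \<noteq> {}"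
    using one_neq_zero by blast
  then have "?L \<noteq> {}"
    using cardL by (metis card.empty card_0_eq finite power_not_zero)
  note rank = bij_betw_rank[OF \<open>finite S\<close>]
  have "bij_betw ?h ?L ?D"
  proof (rule bij_betw_inj_card_eq)
    show "finite ?D"
      using \<open>finite S\<close> by auto
    show "card ?L = card ?D"
      unfolding cardL using \<open>finite S\<close> by (simp add: card_PiE_dflt)
    show "?h ` ?L \<subseteq> ?D"
    proof safe
      fix C assume C: "length C = card S" "set C \<subseteq> UNIV - {0 :: 'f}"
      have "coef S C j \<noteq> 0" if "j \<in> S" for j
      proof -
        have "card {i \<in> S. i < j} < length C"
          using bij_betwE[OF rank] that C(1) by simp
        then have "C ! card {i \<in> S. i < j} \<in> UNIV - {0}"
          using C(2) nth_mem by blast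
        then show ?thesis
          by (simp add: coef_def)
      qed
      then show "?h C \<in> ?D"
        using a by (auto simp: PiE_dflt_def)
    qed
    show "inj_on ?h ?L"
    proof (rule inj_onI)
      fix C C' assume C: "C \<in> ?L" "C' \<in> ?L" and eq: "?h C = ?h C'"
      have coef: "coef S C j = coef S C' j" if "j \<in> S" for j
        using fun_cong[OF eq, of j] that a[OF that] by simp
      show "C = C'"
      proof (rule nth_equalityI)
        \<comment> \<open>Every list position is the rank of some element of \<open>S\<close>, so
          equality of \<open>coef\<close> on \<open>S\<close> reaches all entries.\<close>
        fix i assume "i < length C"
        then obtain j where "j \<in> S" "i = card {j' \<in> S. j' < j}"
          using C rank unfolding bij_betw_def by (metis (mono_tags, lifting) imageE lessThan_iff mem_Collect_eq)
        then show "C ! i = C' ! i"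
          using coef by (simp add: coef_def)
      qed (use C in auto)
    qed
  qed
  then show ?thesis
    unfolding coef_pmf_def using \<open>finite S\<close> finL \<open>?L \<noteq> {}\<close> ne
    by (subst Pi_pmf_of_set) (auto intro!: map_pmf_of_set_bij_betw)
qed

text \<open>The roots are the points with index outside \<open>{W} \<union> S\<close>, and the
  points are distinct. This makes the divisions by \<open>p(\<omega>_j)\<close> in the protocol
  legitimate.\<close>

lemma grs_poly_nonzero:
  assumes "inj_on \<omega> {1..K}" "S \<subseteq> {1..K}" "j \<in> insert W S" "W \<in> {1..K}"
  shows "poly (grs_poly K \<omega> W S) (\<omega> j) \<noteq> 0"
proof -
  have "j \<in> {1..K}"
    using assms by auto
  then have "\<omega> i \<noteq> \<omega> j" if "i \<in> {1..K} - ({W} \<union> S)" for i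
    using that assms by (metis DiffD1 DiffD2 inj_onD insert_is_Un)
  then show ?thesis
    unfolding grs_poly_def by (subst poly_prod_linear_eq_0_iff) auto
qed

text \<open>The heart of privacy: nothing on the right depends on \<open>W\<close> or
  \<open>S\<close>. The random coefficients make the multipliers uniform on \<open>S\<close>, off
  \<open>S\<close> they are drawn so, and the two draws are independent.\<close>

lemma grs_multipliers_uniform:
  fixes \<omega> :: "nat \<Rightarrow> 'f::{field,finite}"
  assumes "inj_on \<omega> {1..K}" "S \<subseteq> {1..K}" "W \<in> {1..K}"
  shows "bind_pmf (coef_pmf (card S)) (grs_multipliers K \<omega> W S)
    = Pi_pmf {1..K} 0 (\<lambda>_. pmf_of_set (UNIV - {0}))"
proof -
  let ?Pi = "\<lambda>T. Pi_pmf T 0 (\<lambda>_. pmf_of_set (UNIV - {0 :: 'f}))"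
  have "finite S"
    using assms finite_subset by blast
  have "?Pi {1..K} = ?Pi (S \<union> ({1..K} - S))"
    using assms by (simp add: Un_absorb1)
  also have "\<dots> = map_pmf (\<lambda>(f, g) x. if x \<in> S then f x else g x) (pair_pmf (?Pi S) (?Pi ({1..K} - S)))"
    using \<open>finite S\<close> by (intro Pi_pmf_union) auto
  also have "?Pi S = map_pmf (\<lambda>C j. if j \<in> S then coef S C j / poly (grs_poly K \<omega> W S) (\<omega> j) else 0)
      (coef_pmf (card S))"
    using assms \<open>finite S\<close> by (intro map_pmf_coef[symmetric] grs_poly_nonzero) auto
  finally show ?thesis
    unfolding grs_multipliers_def[abs_def]
    by (simp add: pair_pmf_def map_pmf_def bind_assoc_pmf bind_return_pmf cong: if_cong)
qed


section \<open>The protocol\<close>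

lemma finite_M_subsets: "finite {S. S \<subseteq> {1..K::nat} \<and> card S = M}"
  by (rule finite_subset[of _ "Pow {1..K}"]) auto

lemma M_subsets_nonempty:
  assumes "M \<le> K"
  shows "{S. S \<subseteq> {1..K::nat} \<and> card S = M} \<noteq> {}"
  using assms obtain_subset_with_card_n[of M "{1..K}"] by auto

lemma set_model_I:
  assumes "M < K" "(W, S) \<in> set_pmf (model_I K M)"
  shows "S \<subseteq> {1..K}" "card S = M" "W \<in> {1..K} - S"
proof -
  have S: "S \<in> {S. S \<subseteq> {1..K} \<and> card S = M} \<and> W \<in> set_pmf (pmf_of_set ({1..K} - S))"
    using assms(2) set_pmf_of_set[OF M_subsets_nonempty finite_M_subsets, of M K] \<open>M < K\<close>
    by (auto simp: model_I_def)
  then show "S \<subseteq> {1..K}" "card S = M"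
    by auto
  \<comment> \<open>The support of \<open>pmf_of_set\<close> is the given set only when that set is
    finite and nonempty.\<close>
  then have "{1..K} - S \<noteq> {}"
    using \<open>M < K\<close> card_seteq[of S "{1..K}"] by auto
  then show "W \<in> {1..K} - S"
    using S by simp
qed

lemma finite_set_model_I:
  assumes "M < K"
  shows "finite (set_pmf (model_I K M))"
proof (rule finite_subset)
  show "set_pmf (model_I K M) \<subseteq> {1..K} \<times> Pow {1..K}"
    using set_model_I[OF assms] by auto
qed simp

lemma finite_set_Pi_pmf_finite_type:
  fixes p :: "'i \<Rightarrow> 'a::finite pmf"
  assumes "finite A"
  shows "finite (set_pmf (Pi_pmf A d p))"
  using assms by (simp add: set_Pi_pmf finite_PiE_dflt)

lemma finite_set_coef_pmf: "finite (set_pmf (coef_pmf M :: 'f::{field,finite} list pmf))"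
proof -
  have fin: "finite {C :: 'f list. length C = M \<and> set C \<subseteq> UNIV - {0}}"
    using finite_lists_length_eq[of "UNIV - {0 :: 'f}" M] by (simp add: conj_commute)
  have "replicate M 1 \<in> {C :: 'f list. length C = M \<and> set C \<subseteq> UNIV - {0}}"
    by auto
  then show ?thesis
    unfolding coef_pmf_def using fin by (subst set_pmf_of_set) blast+
qed

lemma finite_set_run_I_grs:
  assumes "M < K"
  shows "finite (set_pmf (run_I K M (grs_protocol K M emb \<omega>)))"
  unfolding run_I_def set_bind_pmf grs_protocol_def grs_query_def grs_multipliers_def messages_pmf_def
  by (auto simp: finite_set_model_I[OF assms] finite_set_coef_pmf finite_set_Pi_pmf_finite_type
      intro!: finite_UN_I split: prod.splits)

lemma set_run_I_grs:
  fixes \<omega> :: "nat \<Rightarrow> 'f::{field,finite}"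
  assumes "M < K" "inj_on \<omega> {1..K}" "\<xi> \<in> set_pmf (run_I K M (grs_protocol K M emb \<omega>))"
  obtains v where "rv_S \<xi> \<subseteq> {1..K}" "card (rv_S \<xi>) = M" "rv_W \<xi> \<in> {1..K} - rv_S \<xi>"
    "rv_Q \<xi> = grs_matrix K (K - M) \<omega> v" "\<And>j. j \<in> {1..K} \<Longrightarrow> v j \<noteq> 0"
    "\<And>j. j \<in> rv_S \<xi> \<Longrightarrow> v j = coef (rv_S \<xi>) (rv_C \<xi>) j / poly (grs_poly K \<omega> (rv_W \<xi>) (rv_S \<xi>)) (\<omega> j)"
proof -
  obtain W S C X v where mem: "(W, S) \<in> set_pmf (model_I K M)" "C \<in> set_pmf (coef_pmf M)"
      "v \<in> set_pmf (grs_multipliers K \<omega> W S C)"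
    and \<xi>: "\<xi> = Outcome W S C X (grs_matrix K (K - M) \<omega> v)"
    using assms(3) by (auto simp: run_I_def grs_protocol_def grs_query_eq)
  note WS = set_model_I[OF \<open>M < K\<close> mem(1)]
  \<comment> \<open>That no \<open>v j\<close> vanishes is read off from the support of the uniform
    law, without separating \<open>j \<in> S\<close> from \<open>j \<notin> S\<close>.\<close>
  have "v \<in> set_pmf (bind_pmf (coef_pmf (card S)) (grs_multipliers K \<omega> W S))"
    using mem WS by auto
  also have "\<dots> = PiE_dflt {1..K} 0 (\<lambda>_. UNIV - {0})"
  proof -
    have "UNIV - {0 :: 'f} \<noteq> {}"
      using one_neq_zero by blast
    then show ?thesis
      using WS assms(2) by (subst grs_multipliers_uniform) (auto simp: set_Pi_pmf o_def)
  qed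
  finally have "v j \<noteq> 0" if "j \<in> {1..K}" for j
    using that by (auto simp: PiE_dflt_def)
  moreover have "v j = coef S C j / poly (grs_poly K \<omega> W S) (\<omega> j)" if "j \<in> S" for j
    using mem(3) that by (auto simp: grs_multipliers_def)
  ultimately show thesis
    using that[of v] WS by (simp add: \<xi>)
qed

section \<open>Laws of the query and of the answer\<close>

lemma map_pmf_WS_Q_grs:
  fixes \<omega> :: "nat \<Rightarrow> 'f::{field,finite}"
  assumes "M < K" "inj_on \<omega> {1..K}"
  shows "map_pmf (\<lambda>\<xi>. ((rv_W \<xi>, rv_S \<xi>), rv_Q \<xi>)) (run_I K M (grs_protocol K M emb \<omega>))
    = pair_pmf (model_I K M)
        (map_pmf (grs_matrix K (K - M) \<omega>) (Pi_pmf {1..K} 0 (\<lambda>_. pmf_of_set (UNIV - {0}))))"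
proof -
  \<comment> \<open>Summing out the messages leaves the draws of \<open>C\<close> and of the
    multipliers. Merged, these have a law free of \<open>(W, S)\<close>, whence the product
    form.\<close>
  have "map_pmf (\<lambda>\<xi>. ((rv_W \<xi>, rv_S \<xi>), rv_Q \<xi>)) (run_I K M (grs_protocol K M emb \<omega>))
      = bind_pmf (model_I K M) (\<lambda>(W, S). map_pmf (\<lambda>v. ((W, S), grs_matrix K (K - M) \<omega> v))
          (bind_pmf (coef_pmf M) (grs_multipliers K \<omega> W S)))"
    by (simp add: run_I_def grs_protocol_def grs_query_eq map_bind_pmf map_pmf_def bind_assoc_pmf
        bind_return_pmf case_prod_unfold bind_pmf_const)
  also have "\<dots> = bind_pmf (model_I K M) (\<lambda>(W, S). map_pmf (\<lambda>v. ((W, S), grs_matrix K (K - M) \<omega> v))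
          (Pi_pmf {1..K} 0 (\<lambda>_. pmf_of_set (UNIV - {0}))))"
  proof (rule bind_pmf_cong, simp, safe)
    fix W S assume "(W, S) \<in> set_pmf (model_I K M)"
    from set_model_I[OF \<open>M < K\<close> this] assms(2)
    have "bind_pmf (coef_pmf M) (grs_multipliers K \<omega> W S) = Pi_pmf {1..K} 0 (\<lambda>_. pmf_of_set (UNIV - {0}))"
      using grs_multipliers_uniform[of \<omega> K S W] by auto
    then show "map_pmf (\<lambda>v. ((W, S), grs_matrix K (K - M) \<omega> v))
          (bind_pmf (coef_pmf M) (grs_multipliers K \<omega> W S))
        = map_pmf (\<lambda>v. ((W, S), grs_matrix K (K - M) \<omega> v)) (Pi_pmf {1..K} 0 (\<lambda>_. pmf_of_set (UNIV - {0})))"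
      by simp
  qed
  finally show ?thesis
    by (simp add: pair_pmf_def map_pmf_def bind_assoc_pmf bind_return_pmf case_prod_unfold)
qed

text \<open>The messages are independent of the query, and for every query that can occur the answer
  to random messages is uniform; averaging over queries keeps it uniform.\<close>

lemma map_pmf_A_grs:
  fixes emb :: "'f::{field,finite} \<Rightarrow> 'e::{field,finite}"
  assumes "M < K" "inj_on \<omega> {1..K}" "field_embedding emb"
  shows "map_pmf (rv_A (grs_protocol K M emb \<omega>)) (run_I K M (grs_protocol K M emb \<omega>))
    = pmf_of_set {xs. length xs = K - M}"
proof -
  let ?P = "grs_protocol K M emb \<omega>"
  let ?WSQ = "map_pmf (\<lambda>\<xi>. ((rv_W \<xi>, rv_S \<xi>), rv_Q \<xi>)) (run_I K M ?P)"
  have "map_pmf (rv_A ?P) (run_I K M ?P)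
      = bind_pmf (model_I K M) (\<lambda>(W, S). bind_pmf (coef_pmf M) (\<lambda>C. bind_pmf (messages_pmf K)
          (\<lambda>X. map_pmf (\<lambda>Q. grs_answer K emb Q (W \<in> S) X) (grs_query K M \<omega> W S C))))"
    by (simp add: run_I_def grs_protocol_def map_bind_pmf map_pmf_def bind_assoc_pmf
        bind_return_pmf case_prod_unfold rv_A_def rv_ind_def)
  \<comment> \<open>Commuting the draws moves the messages after the query, so that the query can be
    held fixed.\<close>
  also have "\<dots> = bind_pmf ?WSQ (\<lambda>((W, S), Q). map_pmf (grs_answer K emb Q (W \<in> S)) (messages_pmf K))"
    by (simp add: run_I_def grs_protocol_def map_bind_pmf map_pmf_def bind_assoc_pmf
        bind_return_pmf case_prod_unfold bind_pmf_const bind_commute_pmf[of "messages_pmf K"])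
  also have "\<dots> = bind_pmf ?WSQ (\<lambda>_. pmf_of_set {xs. length xs = K - M})"
  proof (rule bind_pmf_cong, simp)
    fix y assume "y \<in> set_pmf ?WSQ"
    then obtain \<xi> where \<xi>: "\<xi> \<in> set_pmf (run_I K M ?P)" "y = ((rv_W \<xi>, rv_S \<xi>), rv_Q \<xi>)"
      by auto
    from set_run_I_grs[OF assms(1,2) \<xi>(1)] obtain v
      where "rv_Q \<xi> = grs_matrix K (K - M) \<omega> v" "\<And>j. j \<in> {1..K} \<Longrightarrow> v j \<noteq> 0"
      by blast
    then show "(\<lambda>((W, S), Q). map_pmf (grs_answer K emb Q (W \<in> S)) (messages_pmf K)) y
        = pmf_of_set {xs. length xs = K - M}"
      using map_pmf_grs_answer[OF assms(3,2), of v "K - M"] by (simp add: \<xi>(2))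
  qed
  finally show ?thesis
    by (simp add: bind_pmf_const)
qed

section \<open>Recoverability, privacy, linearity and rate\<close>

lemma recoverable_I_grs:
  fixes emb :: "'f::{field,finite} \<Rightarrow> 'e::{field,finite}"
  assumes "M < K" "inj_on \<omega> {1..K}" "field_embedding emb"
  shows "recoverable_I K M emb (grs_protocol K M emb \<omega>)"
  unfolding recoverable_I_def
proof (rule pmf_conditional_entropy_determined)
  let ?P = "grs_protocol K M emb \<omega>"
  let ?V = "\<lambda>\<xi>. (rv_A ?P \<xi>, rv_Q \<xi>, rv_ind \<xi>, rv_Y emb \<xi>, rv_W \<xi>, rv_S \<xi>, rv_C \<xi>)"
  show "finite (?V ` set_pmf (run_I K M ?P))"
    using finite_set_run_I_grs[OF \<open>M < K\<close>] by blast
  fix \<xi> \<xi>' assume mem: "\<xi> \<in> set_pmf (run_I K M ?P)" and eq: "?V \<xi> = ?V \<xi>'"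
  \<comment> \<open>Two outcomes that look alike to the user are compared; the goal becomes
    \<open>D W = 0\<close> for the difference \<open>D\<close> of their messages.\<close>
  define W S C D where "W = rv_W \<xi>" and "S = rv_S \<xi>" and "C = rv_C \<xi>"
    and "D j = rv_X \<xi> j - rv_X \<xi>' j" for j
  let ?p = "grs_poly K \<omega> W S"
  from set_run_I_grs[OF assms(1,2) mem] obtain v
    where S: "S \<subseteq> {1..K}" "card S = M" "W \<in> {1..K} - S"
      and Q: "rv_Q \<xi> = grs_matrix K (K - M) \<omega> v" and v: "\<And>j. j \<in> {1..K} \<Longrightarrow> v j \<noteq> 0"
      and vS: "\<And>j. j \<in> S \<Longrightarrow> v j = coef S C j / poly ?p (\<omega> j)"
    unfolding W_def S_def C_def by metis
  have "finite S"
    using S(1) finite_subset by blast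
  have nz: "poly ?p (\<omega> j) \<noteq> 0" if "j \<in> insert W S" for j
    using S that by (intro grs_poly_nonzero assms) auto
  \<comment> \<open>\<open>?p\<close> has exactly \<open>K - M - 1\<close> linear factors, so its
    coefficients fit the \<open>K - M\<close> answers.\<close>
  have "card ({1..K} - insert W S) < K - M"
    using S \<open>M < K\<close> \<open>finite S\<close> by (subst card_Diff_subset) auto
  then have deg: "degree ?p < K - M"
    by (simp add: grs_poly_def degree_prod_linear)
  have A: "grs_answer K emb (grs_matrix K (K - M) \<omega> v) (rv_ind \<xi>) (rv_X \<xi>)
      = grs_answer K emb (grs_matrix K (K - M) \<omega> v) (rv_ind \<xi>) (rv_X \<xi>')"
  proof -
    have "rv_A ?P \<xi> = rv_A ?P \<xi>'" "rv_Q \<xi>' = rv_Q \<xi>" "rv_ind \<xi>' = rv_ind \<xi>"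
      using eq by auto
    then show ?thesis
      by (simp add: rv_A_def grs_protocol_def Q)
  qed
  have Y: "(\<Sum>j\<in>S. emb (coef S C j) * D j) = 0"
  proof -
    have "rv_Y emb \<xi> = rv_Y emb \<xi>'" "rv_S \<xi>' = S" "rv_C \<xi>' = C"
      using eq by (auto simp: S_def C_def)
    then show ?thesis
      by (simp add: rv_Y_def side_info_def S_def[symmetric] C_def[symmetric] D_def
          right_diff_distrib sum_subtractf)
  qed
  have "0 = (\<Sum>j\<in>{1..K}. emb (v j * poly ?p (\<omega> j)) * D j)"
    using grs_poly_annihilates[OF assms(3) A deg] by (simp add: D_def)
  \<comment> \<open>The interfering messages outside \<open>insert W S\<close> sit at roots of
    \<open>?p\<close>.\<close>
  also have "\<dots> = (\<Sum>j\<in>insert W S. emb (v j * poly ?p (\<omega> j)) * D j)"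
  proof (rule sum.mono_neutral_right)
    show "\<forall>j\<in>{1..K} - insert W S. emb (v j * poly ?p (\<omega> j)) * D j = 0"
    proof
      fix j assume "j \<in> {1..K} - insert W S"
      then have "poly ?p (\<omega> j) = 0"
        unfolding grs_poly_def by (subst poly_prod_linear_eq_0_iff) auto
      then show "emb (v j * poly ?p (\<omega> j)) * D j = 0"
        by (simp add: field_embedding_0[OF assms(3)])
    qed
  qed (use S in auto)
  also have "\<dots> = emb (v W * poly ?p (\<omega> W)) * D W + (\<Sum>j\<in>S. emb (v j * poly ?p (\<omega> j)) * D j)"
    using S \<open>finite S\<close> by simp
  \<comment> \<open>Here the choice of multipliers enters: \<open>v j * poly ?p (\<omega> j)\<close>
    equals the side information coefficient, so by \<open>Y\<close> this sum is zero.\<close>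
  also have "(\<Sum>j\<in>S. emb (v j * poly ?p (\<omega> j)) * D j) = (\<Sum>j\<in>S. emb (coef S C j) * D j)"
    using nz by (intro sum.cong) (auto simp: vS)
  finally have "emb (v W * poly ?p (\<omega> W)) * D W = 0"
    using Y by simp
  then have "D W = 0"
    using v[of W] nz[of W] S by (simp add: field_embedding_eq_0_iff[OF assms(3)])
  then show "rv_X \<xi> (rv_W \<xi>) = rv_X \<xi>' (rv_W \<xi>')"
    using eq by (simp add: D_def W_def)
qed

lemma not_rv_ind_run_I_grs:
  assumes "M < K" "inj_on \<omega> {1..K}" "\<xi> \<in> set_pmf (run_I K M (grs_protocol K M emb \<omega>))"
  shows "\<not> rv_ind \<xi>"
  using set_run_I_grs[OF assms] by (auto simp: rv_ind_def)

lemma WS_private_I_grs: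
  assumes "M < K" "inj_on \<omega> {1..K}"
  shows "WS_private_I K M (grs_protocol K M emb \<omega>)"
  unfolding WS_private_I_def
proof (rule pmf_conditional_mutual_information_indep[OF _ _ map_pmf_WS_Q_grs[OF assms]])
  show "rv_ind \<xi> = False" if "\<xi> \<in> set_pmf (run_I K M (grs_protocol K M emb \<omega>))" for \<xi>
    using not_rv_ind_run_I_grs[OF assms that] by simp
qed (use finite_set_run_I_grs[OF \<open>M < K\<close>] in auto)

lemma scalar_linear_grs: "scalar_linear K emb (grs_protocol K M emb \<omega>)"
  unfolding scalar_linear_def
proof (intro allI)
  fix Q b
  show "\<exists>as. \<forall>X. answer (grs_protocol K M emb \<omega>) Q b X = map (\<lambda>a. \<Sum>j\<in>{1..K}. emb (a j) * X j) as"
    \<comment> \<open>Each row of the query serves as a coefficient vector; \<open>j - 1\<close>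
      converts message indices from 1 to list positions from 0.\<close>
    by (rule exI[of _ "map (\<lambda>Qi j. Qi ! (j - 1)) Q"]) (simp add: grs_protocol_def grs_answer_def o_def)
qed

lemma rate_I_grs:
  fixes emb :: "'f::{field,finite} \<Rightarrow> 'e::{field,finite}"
  assumes "M < K" "inj_on \<omega> {1..K}" "field_embedding emb"
    and "CARD('e) = q ^ l" "1 < q" "1 \<le> l"
  shows "rate_I K M q l (grs_protocol K M emb \<omega>) = inverse (real (K - M))"
proof -
  let ?P = "grs_protocol K M emb \<omega>"
  let ?U = "{xs :: 'e list. length xs = K - M}"
  have card: "card ?U = (q ^ l) ^ (K - M)" and fin: "finite ?U"
    using card_lists_length_eq[of "UNIV :: 'e set" "K - M"]
      finite_lists_length_eq[of "UNIV :: 'e set" "K - M"] assms(4) by simp_all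
  have "?U \<noteq> {}"
    using Ex_list_of_length by auto
  have "cond_pmf (run_I K M ?P) {\<xi>. \<not> rv_ind \<xi>} = run_I K M ?P"
    using not_rv_ind_run_I_grs[OF assms(1,2)] by (intro cond_pmf_superset) auto
  then have "pmf_entropy (cond_pmf (run_I K M ?P) {\<xi>. \<not> rv_ind \<xi>}) (rv_A ?P) = log 2 (real (card ?U))"
    using pmf_entropy_uniform[OF map_pmf_A_grs[OF assms(1-3)] fin \<open>?U \<noteq> {}\<close>] by simp
  also have "\<dots> = real (K - M) * (real l * log 2 (real q))"
    using \<open>1 < q\<close> by (simp add: card log_nat_power)
  finally have "rate_I K M q l ?P
      = (real l * log 2 (real q)) / (real (K - M) * (real l * log 2 (real q)))"
    by (simp only: rate_I_def)
  \<comment> \<open>Cancelling \<open>L\<close> in the quotient requires \<open>L\<close> to be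
    nonzero.\<close>
  moreover have "real l * log 2 (real q) \<noteq> 0"
  proof -
    have "0 < log 2 (real q)"
      using \<open>1 < q\<close> by (subst zero_less_log_cancel_iff) auto
    then show ?thesis
      using \<open>1 \<le> l\<close> by simp
  qed
  ultimately show ?thesis
    by (simp add: inverse_eq_divide)
qed

theorem lemma4:
  fixes K M q l :: nat
    and emb :: "'f::{field,finite} \<Rightarrow> 'e::{field,finite}"
    and \<omega> :: "nat \<Rightarrow> 'f"
  assumes "1 \<le> M" and "M \<le> K - 1"
    and "primepow q" and "K \<le> q" and "1 \<le> l"
    and "CARD('f) = q" and "CARD('e) = q ^ l" and "field_embedding emb"
    and "inj_on \<omega> {1..K}"
  shows "PIR_PCSI_I K M emb (grs_protocol K M emb \<omega>)
    \<and> scalar_linear K emb (grs_protocol K M emb \<omega>)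
    \<and> rate_I K M q l (grs_protocol K M emb \<omega>) = inverse (real (K - M))"
proof -
  \<comment> \<open>Subtraction is truncated, so \<open>M \<le> K - 1\<close> alone would admit
    \<open>K = M = 0\<close>; \<open>1 \<le> M\<close> excludes this.\<close>
  have "M < K"
    using assms by linarith
  moreover have "1 < q"
    using primepow_gt_Suc_0[OF assms(3)] by simp
  ultimately show ?thesis
    unfolding PIR_PCSI_I_def using assms
    by (intro conjI recoverable_I_grs WS_private_I_grs scalar_linear_grs rate_I_grs)
qed

end
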